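(* Let $\mathcal{C}$ and $\mathcal{W}$ be path-connected spaces, where $\mathcal{W}$ is a metric ANR space, and let $f\colon\mathcal{C}\to\mathcal{W}$ be any continuous surjective map. Then $$\mathrm{cat}(\mathcal{W})\le\mathrm{csec}(f)\le\mathrm{TC}(f)<\mathrm{csec}(f)+\mathrm{cat}(\mathcal{C}).$$
   Context: All maps and sections (including partial sections) are continuous. Spaces are nonempty. A metric ANR space is a metrizable space that is an absolute neighbourhood retract for metrizable spaces. Topological complexity of a map: let $\mathcal{C}$ and $\mathcal{W}$ be path-connected spaces and $f\colon\mathcal{C}\to\mathcal{W}$ a continuous surjective map. Let $I=[0,1]$, let $\mathcal{C}^I$ be the space of all continuous paths $\alpha\colon I\to\mathcal{C}$ (with the compact-open topology), and let $\pi_f\colon\mathcal{C}^I\to\mathcal{C}\times\mathcal{W}$ be given by $\pi_f(\alpha)=(\alpha(0),f(\alpha(1)))$. A partial section of $\pi_f$ over $Q\subseteq\mathcal{C}\times\mathcal{W}$ is a continuous map $\alpha\colon Q\to\mathcal{C}^I$ with $\pi_f\circ\alpha$ equal to the inclusion of $Q$. Then $\mathrm{TC}(f)$ is the minimal $n$ for which there exists a filtration of $\mathcal{C}\times\mathcal{W}$ by closed sets $$\emptyset=Q_0\subseteq Q_1\subseteq\ldots\subseteq Q_n=\mathcal{C}\times\mathcal{W}$$ such that $\pi_f$ admits a partial section over $Q_i-Q_{i-1}$ for each $i=1,\ldots,n$ (and $\mathrm{TC}(f)=\infty$ if no such $n$ exists). Categorical sections: a partial section of $f$ over $A\subseteq\mathcal{W}$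 is a continuous map $s\colon A\to\mathcal{C}$ with $f(s(w))=w$ for all $w\in A$; it is categorical if $s(A)$ can be deformed to a point within $\mathcal{C}$, i.e. the inclusion $s(A)\hookrightarrow\mathcal{C}$ is homotopic to a constant map. Then $\mathrm{csec}(f)$ is the minimal $n$ for which there is a filtration of $\mathcal{W}$ by closed subsets $$\emptyset=A_0\subseteq A_1\subseteq\ldots\subseteq A_n=\mathcal{W}$$ such that $f$ admits a categorical section over $A_i-A_{i-1}$ for each $i=1,\ldots,n$ (and $\mathrm{csec}(f)=\infty$ if no such $n$ exists). Category: $\mathrm{cat}(X)$ is the non-normalized Lusternik-Schnirelmann category, i.e. the minimal $n$ such that $X$ can be covered by $n$ open subsets each of whose inclusions into $X$ is homotopic to a constant map (so $\mathrm{cat}$ of a contractible space is $1$), and $\mathrm{cat}(X)=\infty$ if no such $n$ exists. Convention: the strict inequality is understood as $\mathrm{TC}(f)\le\mathrm{csec}(f)+\mathrm{cat}(\mathcal{C})-1$, being vacuous when the right-hand side is infinite. *)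

theory Defs
  imports "HOL-Analysis.Analysis"
begin

text \<open>
  The compact-open topology on the set of continuous maps from \<open>X\<close> to \<open>Y\<close>. A map between the
  carriers is represented by the function that is \<open>undefined\<close> outside \<open>topspace X\<close>, so that
  distinct points of the space are distinct maps. The subbasic set with \<open>K = {}\<close> is the whole
  space.
\<close>

definition continuous_maps :: "'a topology \<Rightarrow> 'b topology \<Rightarrow> ('a \<Rightarrow> 'b) set" where
  "continuous_maps X Y = {g \<in> extensional (topspace X). continuous_map X Y g}"

definition compact_open_topology :: "'a topology \<Rightarrow> 'b topology \<Rightarrow> ('a \<Rightarrow> 'b) topology" where
  "compact_open_topology X Y =
     topology_generated_by
       {{g \<in> continuous_maps X Y. g ` K \<subseteq> U} | K U. compactin X K \<and> openin Y U}"

definition path_space :: "'a topology \<Rightarrow> (real \<Rightarrow> 'a) topology" where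
  "path_space X = compact_open_topology (top_of_set {0..1}) X"

definition path_fibration :: "('c \<Rightarrow> 'w) \<Rightarrow> (real \<Rightarrow> 'c) \<Rightarrow> 'c \<times> 'w" where
  "path_fibration f \<alpha> = (\<alpha> 0, f (\<alpha> 1))"

definition partial_section ::
  "'e topology \<Rightarrow> 'b topology \<Rightarrow> ('e \<Rightarrow> 'b) \<Rightarrow> 'b set \<Rightarrow> ('b \<Rightarrow> 'e) \<Rightarrow> bool" where
  "partial_section E B p A s \<longleftrightarrow>
     A \<subseteq> topspace B \<and> continuous_map (subtopology B A) E s \<and> (\<forall>b\<in>A. p (s b) = b)"

definition contractible_within :: "'a topology \<Rightarrow> 'a set \<Rightarrow> bool" where
  "contractible_within X S \<longleftrightarrow>
     S \<subseteq> topspace X \<and>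
     (\<exists>c\<in>topspace X. homotopic_with (\<lambda>_. True) (subtopology X S) X id (\<lambda>_. c))"

definition closed_filtration :: "'a topology \<Rightarrow> nat \<Rightarrow> (nat \<Rightarrow> 'a set) \<Rightarrow> bool" where
  "closed_filtration X n A \<longleftrightarrow>
     A 0 = {} \<and> A n = topspace X \<and> (\<forall>i\<le>n. closedin X (A i)) \<and> (\<forall>i<n. A i \<subseteq> A (Suc i))"

text \<open>
  The three invariants below are minima of sets of natural numbers, taken in \<^typ>\<open>enat\<close> so that
  the infimum of the empty set is \<open>\<infinity>\<close>. A stratum \<open>A i - A (i - 1)\<close> with \<open>1 \<le> i \<le> n\<close> is written
  \<open>A (Suc i) - A i\<close> with \<open>i < n\<close>.
\<close>

definition TC :: "'c topology \<Rightarrow> 'w topology \<Rightarrow> ('c \<Rightarrow> 'w) \<Rightarrow> enat" where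
  "TC C W f =
     Inf {enat n | n. \<exists>Q. closed_filtration (prod_topology C W) n Q \<and>
       (\<forall>i<n. \<exists>\<sigma>. partial_section (path_space C) (prod_topology C W) (path_fibration f)
                    (Q (Suc i) - Q i) \<sigma>)}"

definition categorical_section ::
  "'c topology \<Rightarrow> 'w topology \<Rightarrow> ('c \<Rightarrow> 'w) \<Rightarrow> 'w set \<Rightarrow> ('w \<Rightarrow> 'c) \<Rightarrow> bool" where
  "categorical_section C W f A s \<longleftrightarrow>
     partial_section C W f A s \<and> contractible_within C (s ` A)"

definition csec :: "'c topology \<Rightarrow> 'w topology \<Rightarrow> ('c \<Rightarrow> 'w) \<Rightarrow> enat" where
  "csec C W f =
     Inf {enat n | n. \<exists>A. closed_filtration W n A \<and>
       (\<forall>i<n. \<exists>s. categorical_section C W f (A (Suc i) - A i) s)}"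

definition LS_cat :: "'a topology \<Rightarrow> enat" where
  "LS_cat X =
     Inf {enat n | n. \<exists>U. (\<forall>i<n. openin X (U i) \<and> contractible_within X (U i)) \<and>
       (\<Union>i<n. U i) = topspace X}"

text \<open>
  A metrizable space \<open>W\<close> is an absolute neighbourhood retract for metrizable spaces if, for every
  closed embedding into a metrizable space \<open>Y\<close>, its image is a retract of an open neighbourhood
  in \<open>Y\<close>. A definition cannot quantify over all types, so \<open>Y\<close> ranges over the metrizable spaces
  with points in \<^typ>\<open>'a \<Rightarrow> real\<close>. Formally this asks for less than the condition for all types.
  It asks for exactly as much: by the Kuratowski-Wojdyslawski theorem, \<open>W\<close> is homeomorphic to a
  closed subset of a convex set of bounded real functions on \<open>W\<close> with the supremum metric. If
  \<open>W\<close> is a retract of a neighbourhood in that convex set, Dugundji's extension theorem makes it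
  a neighbourhood retract in every metrizable space that contains it as a closed subspace.
\<close>

definition metric_ANR_space :: "'a topology \<Rightarrow> bool" where
  "metric_ANR_space W \<longleftrightarrow>
     metrizable_space W \<and>
     (\<forall>(Y :: ('a \<Rightarrow> real) topology) e.
        metrizable_space Y \<and> embedding_map W Y e \<and> closedin Y (e ` topspace W) \<longrightarrow>
        (\<exists>U. openin Y U \<and> e ` topspace W \<subseteq> U \<and>
             (e ` topspace W) retract_of_space (subtopology Y U)))"

end

theory Submission
  imports Defs
begin

text \<open>
  The bridge between the three invariants is that path sections are homotopies. A partial section
  of the path fibration over \<open>T \<subseteq> C \<times> W\<close> is, by currying, a homotopy in \<open>C\<close> from the first
  projection \<open>T \<rightarrow> C\<close> to a map \<open>g\<close> with \<open>f (g p) = snd p\<close>; this is \<open>path_section_iff_homotopy\<close>.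

  \<^item> \<open>csec C W f \<le> TC C W f\<close>: restrict such homotopies to a slice \<open>{c} \<times> W\<close>. The first projection
    becomes the constant \<open>c\<close>, so \<open>w \<mapsto> g (c, w)\<close> is a section homotopic to a constant, and since it
    is a homeomorphism onto its image with inverse \<open>f\<close>, that image deforms to \<open>c\<close>
    (\<open>csec_le_TC\<close>).

  \<^item> \<open>TC C W f \<le> csec C W f + LS_cat C - 1\<close>: over \<open>E \<times> A\<close>, where \<open>E\<close> is contractible within \<open>C\<close>
    and \<open>s\<close> is a categorical section over \<open>A\<close>, both the first projection and \<open>(b, a) \<mapsto> s a\<close> are
    homotopic to a constant, hence to each other. An open cover of \<open>C\<close> by \<open>m\<close> sets yields a closed
    filtration of length \<open>m\<close>; its product with a filtration of \<open>W\<close> of length \<open>n\<close>, graded by the sum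
    of the two indices, has \<open>m + n - 1\<close> strata, and each of them is a finite disjoint union of
    relatively closed products of strata (\<open>TC_le_csec_plus_cat\<close>).

  \<^item> \<open>LS_cat W \<le> csec C W f\<close>: composing with \<open>f\<close> shows that a stratum \<open>S\<close> with a categorical section
    is contractible within \<open>W\<close>. Strata are only locally closed, whereas \<open>LS_cat\<close> asks for open sets;
    this is where the ANR hypothesis enters. With \<open>S\<close> closed in an open set \<open>V\<close>, the contraction of
    \<open>S\<close>, the inclusion of \<open>V\<close> at time 0 and a constant map at time 1 fit together to a map on a closed
    subset of \<open>{0..1} \<times> V\<close>. It extends to a neighbourhood, which contains \<open>{0..1} \<times> V'\<close> for some open
    \<open>V' \<supseteq> S\<close> (\<open>metric_ANR_contractible_neighbourhood\<close>).

  The last step needs a metric ANR space \<open>W\<close> to have the neighbourhood extension property for all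
  metrizable pairs \<open>(Z, A)\<close>, while the definition speaks of retractions in spaces of functions
  \<open>'w \<Rightarrow> real\<close>. Kuratowski's isometry sends \<open>w\<close> to the function \<open>d w\<close>, whose infimum is 0. Adding
  to its image all bounded functions with positive infimum gives a space in which \<open>W\<close> is closed. A
  map \<open>g: A \<rightarrow> W\<close> extends over \<open>Z\<close> to a map into that space: extend the equicontinuous family
  \<open>a \<mapsto> d (g a) s\<close>, indexed by \<open>s\<close>, to an equicontinuous family on \<open>Z\<close>, and add the distance to \<open>A\<close>
  in order to make the infimum positive off \<open>A\<close>. The retraction then finishes the argument
  (\<open>metric_ANR_neighbourhood_extension\<close>).
\<close>

section \<open>The exponential law for the compact-open topology\<close>

lemma openin_tube:
  assumes K: "compactin X K" and N: "openin (prod_topology X Y) N"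
  shows "openin Y {y \<in> topspace Y. K \<times> {y} \<subseteq> N}"
proof (subst openin_subopen, intro ballI)
  fix y assume "y \<in> {y \<in> topspace Y. K \<times> {y} \<subseteq> N}"
  then have y: "y \<in> topspace Y" "K \<times> {y} \<subseteq> N" by auto
  then obtain U V where UV: "openin X U" "openin Y V" "K \<subseteq> U" "y \<in> V" "U \<times> V \<subseteq> N"
    using tube_lemma_left[OF N K, of y] by blast
  then show "\<exists>T. openin Y T \<and> y \<in> T \<and> T \<subseteq> {y \<in> topspace Y. K \<times> {y} \<subseteq> N}"
    using openin_subset by (intro exI[of _ V]) blast
qed

text \<open>
  Currying is continuous for every \<open>X\<close>, since the preimage of a subbasic open set is the open set of
  \<open>y\<close> whose tube over the compact set \<open>K\<close> lies in an open set of the product.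
\<close>

lemma continuous_map_curry:
  assumes H: "continuous_map (prod_topology X Y) Z H"
  shows "continuous_map Y (compact_open_topology X Z)
           (\<lambda>y. restrict (\<lambda>x. H (x, y)) (topspace X))"
  unfolding compact_open_topology_def
proof (rule continuous_on_generated_topo)
  let ?c = "\<lambda>y. restrict (\<lambda>x. H (x, y)) (topspace X)"
  have c: "?c y \<in> continuous_maps X Z" if "y \<in> topspace Y" for y
  proof -
    have "continuous_map X Z (\<lambda>x. H (x, y))"
      using continuous_map_compose[OF _ H, of X "\<lambda>x. (x, y)"] that
      by (simp add: o_def continuous_map_pairwise)
    then have "continuous_map X Z (?c y)"
      by (rule continuous_map_eq) auto
    then show ?thesis
      by (auto simp: continuous_maps_def)
  qed
  show "openin Y (?c -` S \<inter> topspace Y)"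
    if "S \<in> {{g \<in> continuous_maps X Z. g ` K \<subseteq> U} |K U. compactin X K \<and> openin Z U}" for S
  proof -
    from that obtain K U where S: "S = {g \<in> continuous_maps X Z. g ` K \<subseteq> U}"
      and K: "compactin X K" and U: "openin Z U" by blast
    have KX: "K \<subseteq> topspace X"
      using K compactin_subset_topspace by blast
    let ?N = "{p \<in> topspace (prod_topology X Y). H p \<in> U}"
    have "openin (prod_topology X Y) ?N"
      using H U by (rule openin_continuous_map_preimage)
    then have "openin Y {y \<in> topspace Y. K \<times> {y} \<subseteq> ?N}"
      by (rule openin_tube[OF K])
    also have "{y \<in> topspace Y. K \<times> {y} \<subseteq> ?N} = ?c -` S \<inter> topspace Y"
      using KX c by (auto simp: S image_subset_iff subset_iff)
    finally show ?thesis .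
  qed
  have "{g \<in> continuous_maps X Z. g ` {} \<subseteq> {}} \<in>
      {{g \<in> continuous_maps X Z. g ` K \<subseteq> U} |K U. compactin X K \<and> openin Z U}"
    by blast
  then have "continuous_maps X Z \<in>
      {{g \<in> continuous_maps X Z. g ` K \<subseteq> U} |K U. compactin X K \<and> openin Z U}"
    by simp
  then show "?c ` topspace Y \<subseteq>
      \<Union> {{g \<in> continuous_maps X Z. g ` K \<subseteq> U} |K U. compactin X K \<and> openin Z U}"
    using c by blast
qed

lemma topspace_compact_open_topology [simp]:
  "topspace (compact_open_topology X Z) = continuous_maps X Z"
proof -
  have "{g \<in> continuous_maps X Z. g ` {} \<subseteq> {}} \<in>
      {{g \<in> continuous_maps X Z. g ` K \<subseteq> U} |K U. compactin X K \<and> openin Z U}"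
    by blast
  then show ?thesis
    unfolding compact_open_topology_def topology_generated_by_topspace by fastforce
qed

lemma openin_compact_open_topology:
  assumes "compactin X K" "openin Z U"
  shows "openin (compact_open_topology X Z) {g \<in> continuous_maps X Z. g ` K \<subseteq> U}"
  unfolding compact_open_topology_def using assms
  by (intro topology_generated_by_Basis) blast

text \<open>
  Evaluation is continuous at \<open>(x, y)\<close> because \<open>x\<close> has a compact neighbourhood on which \<open>s y\<close> stays
  in a given open set: being mapped into that set is an open condition on \<open>s y\<close>.
\<close>

lemma continuous_map_uncurry:
  assumes X: "neighbourhood_base_of (compactin X) X"
    and s: "continuous_map Y (compact_open_topology X Z) s"
  shows "continuous_map (prod_topology X Y) Z (\<lambda>(x, y). s y x)"
  unfolding continuous_map_eq_topcontinuous_at topcontinuous_at_def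
proof (intro ballI conjI allI impI)
  have sc: "s y \<in> continuous_maps X Z" if "y \<in> topspace Y" for y
    using continuous_map_image_subset_topspace[OF s] that by auto
  have cs: "continuous_map X Z (s y)" if "y \<in> topspace Y" for y
    using sc[OF that] by (simp add: continuous_maps_def)
  fix p assume p: "p \<in> topspace (prod_topology X Y)"
  then obtain x y where xy: "p = (x, y)" "x \<in> topspace X" "y \<in> topspace Y" by auto
  show "p \<in> topspace (prod_topology X Y)" by fact
  show "(\<lambda>(x, y). s y x) \<in> topspace (prod_topology X Y) \<rightarrow> topspace Z"
    using cs continuous_map_image_subset_topspace by fastforce
  fix U assume U: "openin Z U \<and> (case p of (x, y) \<Rightarrow> s y x) \<in> U"
  have "openin X {x' \<in> topspace X. s y x' \<in> U}"
    using cs[OF xy(3)] U by (intro openin_continuous_map_preimage) auto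
  moreover have "x \<in> {x' \<in> topspace X. s y x' \<in> U}"
    using xy U by auto
  ultimately have "\<exists>V K. openin X V \<and> compactin X K \<and> x \<in> V \<and> V \<subseteq> K \<and>
      K \<subseteq> {x' \<in> topspace X. s y x' \<in> U}"
    using X unfolding neighbourhood_base_of by blast
  then obtain V K where V: "openin X V" "x \<in> V" "V \<subseteq> K" and K: "compactin X K"
    and KU: "K \<subseteq> {x' \<in> topspace X. s y x' \<in> U}"
    by blast
  let ?B = "{y' \<in> topspace Y. s y' \<in> {g \<in> continuous_maps X Z. g ` K \<subseteq> U}}"
  have "openin Y ?B"
    using openin_continuous_map_preimage[OF s openin_compact_open_topology[OF K]] U by blast
  then have "openin (prod_topology X Y) (V \<times> ?B)"
    using V by (simp add: openin_prod_Times_iff)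
  moreover have "p \<in> V \<times> ?B"
    using xy V KU sc by auto
  moreover have "\<forall>q\<in>V \<times> ?B. (case q of (x, y) \<Rightarrow> s y x) \<in> U"
    using V by auto
  ultimately show "\<exists>Ua. openin (prod_topology X Y) Ua \<and> p \<in> Ua \<and>
       (\<forall>q\<in>Ua. (case q of (x, y) \<Rightarrow> s y x) \<in> U)"
    by blast
qed

lemma neighbourhood_base_compact_unit_interval:
  "neighbourhood_base_of (compactin (top_of_set {0..1::real})) (top_of_set {0..1})"
proof -
  have "locally_compact_space (top_of_set {0..1::real})"
    by (simp add: compact_imp_locally_compact_space compact_space_subtopology)
  then show ?thesis
    using locally_compact_space_neighbourhood_base by (metis Hausdorff_space_euclidean Hausdorff_space_subtopology)
qed

section \<open>Path sections as homotopies\<close>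

text \<open>
  The time parameter of the homotopy is the parameter of the path, so both directions are the
  exponential law for the compact-open topology on paths. Phrased by homotopies, the concatenation
  and reversal of paths become transitivity and symmetry of \<open>homotopic_with\<close>.
\<close>

lemma path_section_iff_homotopy:
  fixes C :: "'c topology" and W :: "'w topology" and f :: "'c \<Rightarrow> 'w"
  assumes T: "T \<subseteq> topspace (prod_topology C W)"
  shows "(\<exists>\<sigma>. partial_section (path_space C) (prod_topology C W) (path_fibration f) T \<sigma>) \<longleftrightarrow>
         (\<exists>g. homotopic_with (\<lambda>_. True) (subtopology (prod_topology C W) T) C fst g \<and>
              (\<forall>p\<in>T. f (g p) = snd p))"
proof
  let ?X = "subtopology (prod_topology C W) T" and ?I = "top_of_set {0..1::real}"
  have tX: "topspace ?X = T" using T by auto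
  {
    assume "\<exists>\<sigma>. partial_section (path_space C) (prod_topology C W) (path_fibration f) T \<sigma>"
    then obtain \<sigma> where s: "continuous_map ?X (path_space C) \<sigma>"
      and p: "\<forall>b\<in>T. path_fibration f (\<sigma> b) = b"
      by (auto simp: partial_section_def)
    have "continuous_map (prod_topology ?I ?X) C (\<lambda>(t, b). \<sigma> b t)"
      using continuous_map_uncurry[OF neighbourhood_base_compact_unit_interval] s by (simp add: path_space_def)
    then have "homotopic_with (\<lambda>_. True) ?X C (\<lambda>b. \<sigma> b 0) (\<lambda>b. \<sigma> b 1)"
      unfolding homotopic_with_def by (intro exI[of _ "\<lambda>(t, b). \<sigma> b t"]) auto
    then have "homotopic_with (\<lambda>_. True) ?X C fst (\<lambda>b. \<sigma> b 1)"
      by (rule homotopic_with_eq) (use p tX in \<open>force simp: path_fibration_def\<close>)+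
    moreover have "\<forall>b\<in>T. f (\<sigma> b 1) = snd b"
      using p by (force simp: path_fibration_def)
    ultimately show "\<exists>g. homotopic_with (\<lambda>_. True) ?X C fst g \<and> (\<forall>p\<in>T. f (g p) = snd p)"
      by blast
  next
    assume "\<exists>g. homotopic_with (\<lambda>_. True) ?X C fst g \<and> (\<forall>p\<in>T. f (g p) = snd p)"
    then obtain g H where H: "continuous_map (prod_topology ?I ?X) C H"
      and H01: "\<And>b. H (0, b) = fst b" "\<And>b. H (1, b) = g b" and g: "\<forall>p\<in>T. f (g p) = snd p"
      by (auto simp: homotopic_with_def)
    let ?s = "\<lambda>b. restrict (\<lambda>t. H (t, b)) (topspace ?I)"
    have "continuous_map ?X (path_space C) ?s"
      using continuous_map_curry[OF H] by (simp add: path_space_def)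
    moreover have "\<forall>b\<in>T. path_fibration f (?s b) = b"
      using g by (simp add: path_fibration_def H01)
    ultimately show "\<exists>\<sigma>. partial_section (path_space C) (prod_topology C W) (path_fibration f) T \<sigma>"
      using T by (auto simp: partial_section_def)
  }
qed

text \<open>
  In a path-connected space the end point of a contraction can be prescribed, which lets contractions
  of different sets be compared.
\<close>

lemma contractible_withinD:
  assumes "path_connected_space X" "contractible_within X S" "c \<in> topspace X"
  shows "homotopic_with (\<lambda>_. True) (subtopology X S) X id (\<lambda>_. c)"
proof -
  obtain c' where c': "c' \<in> topspace X" "homotopic_with (\<lambda>_. True) (subtopology X S) X id (\<lambda>_. c')"
    using assms by (auto simp: contractible_within_def)
  have "path_component_of X c' c"
    using assms(1,3) c'(1) by (simp add: path_connected_space_def path_component_of_def)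
  then show ?thesis
    by (intro homotopic_with_trans[OF c'(2)] iffD2[OF homotopic_constant_maps] disjI2)
qed

lemma contractible_within_subset:
  assumes "contractible_within X S" "T \<subseteq> S"
  shows "contractible_within X T"
  using assms unfolding contractible_within_def
  by (metis homotopic_from_subtopology inf.absorb_iff2 order_trans subtopology_subtopology)

text \<open>
  A motion planner that starts at a fixed configuration \<open>c\<close> reaches every \<open>w\<close> along a path that
  depends continuously on \<open>w\<close>. Its end point is a section, and running the paths backwards contracts
  the image of this section to \<open>c\<close>.
\<close>

lemma csec_le_TC:
  assumes C: "topspace C \<noteq> {}" and f: "continuous_map C W f"
  shows "csec C W f \<le> TC C W f"
  unfolding csec_def TC_def
proof (rule Inf_superset_mono, clarify)
  fix n Q
  assume Q: "closed_filtration (prod_topology C W) n Q"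
    and sec: "\<forall>i<n. \<exists>\<sigma>. partial_section (path_space C) (prod_topology C W) (path_fibration f)
                    (Q (Suc i) - Q i) \<sigma>"
  obtain c where c: "c \<in> topspace C" using C by blast
  let ?j = "\<lambda>w. (c, w)"
  define A where "A i = {w \<in> topspace W. (c, w) \<in> Q i}" for i
  have j: "continuous_map W (prod_topology C W) ?j"
    using c by (simp add: continuous_map_pairwise o_def)
  have A: "closed_filtration W n A"
    using Q closedin_continuous_map_preimage[OF j] c
    by (auto simp: closed_filtration_def A_def)
  have "\<exists>s. categorical_section C W f (A (Suc i) - A i) s" if "i < n" for i
  proof -
    let ?T = "Q (Suc i) - Q i" and ?A = "A (Suc i) - A i"
    have T: "?T \<subseteq> topspace (prod_topology C W)"
      using Q that unfolding closed_filtration_def by (meson Diff_subset Suc_leI closedin_subset order_trans)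
    have "\<exists>g. homotopic_with (\<lambda>_. True) (subtopology (prod_topology C W) ?T) C fst g \<and>
              (\<forall>p\<in>?T. f (g p) = snd p)"
      using sec that by (intro iffD1[OF path_section_iff_homotopy[OF T]]) simp
    then obtain g where g: "homotopic_with (\<lambda>_. True) (subtopology (prod_topology C W) ?T) C fst g"
      and fg: "\<forall>p\<in>?T. f (g p) = snd p"
      by blast
    define s where "s w = g (c, w)" for w
    have AT: "\<And>w. w \<in> ?A \<Longrightarrow> (c, w) \<in> ?T" and AW: "?A \<subseteq> topspace W"
      by (auto simp: A_def)
    have "continuous_map (subtopology W ?A) (subtopology (prod_topology C W) ?T) ?j"
      using j AT by (auto simp: continuous_map_in_subtopology continuous_map_from_subtopology)
    from homotopic_with_compose_continuous_map_right[OF g this]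
    have "homotopic_with (\<lambda>_. True) (subtopology W ?A) C (fst \<circ> ?j) (g \<circ> ?j)" by simp
    then have hs: "homotopic_with (\<lambda>_. True) (subtopology W ?A) C (\<lambda>_. c) s"
      by (rule homotopic_with_eq) (auto simp: s_def)
    then have sc: "continuous_map (subtopology W ?A) C s"
      using homotopic_with_imp_continuous_maps by blast
    have fs: "\<And>w. w \<in> ?A \<Longrightarrow> f (s w) = w"
      using fg AT by (auto simp: s_def)
    have sA: "s ` ?A \<subseteq> topspace C"
      using continuous_map_image_subset_topspace[OF sc] AW by auto
    \<comment> \<open>Precomposing with \<open>f\<close>, the inverse of \<open>s\<close>, moves the homotopy from \<open>?A\<close> to its image.\<close>
    have "continuous_map (subtopology C (s ` ?A)) (subtopology W ?A) f"
      using f fs by (auto simp: continuous_map_in_subtopology continuous_map_from_subtopology)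
    from homotopic_with_compose_continuous_map_right[OF hs this]
    have "homotopic_with (\<lambda>_. True) (subtopology C (s ` ?A)) C ((\<lambda>_. c) \<circ> f) (s \<circ> f)" by simp
    then have "homotopic_with (\<lambda>_. True) (subtopology C (s ` ?A)) C (\<lambda>_. c) id"
      by (rule homotopic_with_eq) (use fs in auto)
    then have "contractible_within C (s ` ?A)"
      using sA c homotopic_with_symD[of "\<lambda>_. True" _ C "\<lambda>_. c" id]
      unfolding contractible_within_def by blast
    then show ?thesis
      using sc fs AW by (auto simp: categorical_section_def partial_section_def)
  qed
  then show "\<exists>n'. enat n = enat n' \<and> (\<exists>A. closed_filtration W n' A \<and>
       (\<forall>i<n'. \<exists>s. categorical_section C W f (A (Suc i) - A i) s))"
    using A by blast
qed

section \<open>Products of filtrations\<close>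

text \<open>
  The \<open>j\<close>-th closed set consists of the points that lie in none of \<open>U j, U (j + 1), \<dots>\<close>. A point that
  enters at step \<open>j + 1\<close> lies in one of these sets but in none of \<open>U (j + 1), U (j + 2), \<dots>\<close>, hence in
  \<open>U j\<close>.
\<close>

lemma closed_filtration_from_open_cover:
  assumes U: "\<And>j. j < m \<Longrightarrow> openin X (U j)" and cover: "(\<Union>j<m. U j) = topspace X"
  obtains B where "closed_filtration X m B" "\<forall>j<m. B (Suc j) - B j \<subseteq> U j"
proof
  let ?B = "\<lambda>j. topspace X - (\<Union>k\<in>{j..<m}. U k)"
  have "openin X (\<Union>k\<in>{j..<m}. U k)" for j
    using U by (intro openin_Union) auto
  moreover have "?B 0 = {}" using cover by (simp add: lessThan_atLeast0)
  moreover have "?B m = topspace X" by simp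
  ultimately show "closed_filtration X m ?B"
    unfolding closed_filtration_def by (auto simp: closedin_diff)
  show "\<forall>j<m. ?B (Suc j) - ?B j \<subseteq> U j"
  proof (intro allI impI subsetI)
    fix j x assume "j < m" and x: "x \<in> ?B (Suc j) - ?B j"
    then obtain k where k: "k \<in> {j..<m}" "x \<in> U k" by blast
    moreover have "k \<notin> {Suc j..<m}" using x k by blast
    ultimately show "x \<in> U j" by (auto simp: not_less_eq_eq le_antisym Suc_le_eq)
  qed
qed

lemma filtration_mono:
  assumes "closed_filtration X n A" "i \<le> j" "j \<le> n"
  shows "A i \<subseteq> A j"
  using assms(2,3)
proof (induction j rule: dec_induct)
  case (step j)
  then have "A j \<subseteq> A (Suc j)"
    using assms(1) by (simp add: closed_filtration_def)
  with step show ?case by simp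
qed simp

lemma filtration_stratum:
  assumes A: "closed_filtration X n A" and x: "x \<in> topspace X"
  obtains i where "i < n" "x \<in> A (Suc i) - A i"
proof -
  have n: "x \<in> A n"
    using A x by (simp add: closed_filtration_def)
  define k where "k = (LEAST k. x \<in> A k)"
  have k: "x \<in> A k" "k \<le> n" "\<And>i. i < k \<Longrightarrow> x \<notin> A i"
    using n unfolding k_def by (auto intro: LeastI Least_le dest: not_less_Least)
  then have "k \<noteq> 0" using A by (metis closed_filtration_def empty_iff)
  then obtain i where "k = Suc i" by (cases k) auto
  with k show ?thesis using that[of i] by auto
qed

lemma filtration_stratum_iff:
  assumes A: "closed_filtration X n A" and x: "i < n" "x \<in> A (Suc i) - A i" and k: "k \<le> n"
  shows "x \<in> A k \<longleftrightarrow> i < k"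
proof
  assume "x \<in> A k"
  then show "i < k" using filtration_mono[OF A, of k i] x by (meson DiffD2 less_imp_le linorder_not_le subsetD)
next
  assume "i < k"
  then show "x \<in> A k" using filtration_mono[OF A, of "Suc i" k] x k by auto
qed

lemma filtration_strata_disjoint:
  assumes A: "closed_filtration X n A" and ij: "i < n" "j < n" "i \<noteq> j"
  shows "(A (Suc i) - A i) \<inter> (A (Suc j) - A j) = {}"
proof -
  have "A (Suc i) \<subseteq> A j \<or> A (Suc j) \<subseteq> A i"
    using filtration_mono[OF A] ij by (meson Suc_leI less_imp_le linorder_neqE_nat)
  then show ?thesis by blast
qed

text \<open>
  The bound is \<open>Suc k\<close> because a product is nonempty only if both indices are positive; the smallest
  index sum of a nonempty product, 2, must first occur at step 1.
\<close>

definition product_filtration ::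
  "nat \<Rightarrow> (nat \<Rightarrow> 'a set) \<Rightarrow> nat \<Rightarrow> (nat \<Rightarrow> 'b set) \<Rightarrow> nat \<Rightarrow> ('a \<times> 'b) set" where
  "product_filtration m B n A k =
     (\<Union>(j, i)\<in>{(j, i). j \<le> m \<and> i \<le> n \<and> i + j \<le> Suc k}. B j \<times> A i)"

lemma in_product_filtration_iff:
  assumes B: "closed_filtration X m B" and A: "closed_filtration Y n A"
    and b: "j < m" "b \<in> B (Suc j) - B j" and a: "i < n" "a \<in> A (Suc i) - A i"
  shows "(b, a) \<in> product_filtration m B n A k \<longleftrightarrow> i + j < k"
proof
  assume "(b, a) \<in> product_filtration m B n A k"
  then obtain j' i' where "j' \<le> m" "i' \<le> n" "i' + j' \<le> Suc k" "b \<in> B j'" "a \<in> A i'"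
    unfolding product_filtration_def by blast
  moreover from this have "j < j'" "i < i'"
    using filtration_stratum_iff[OF B b] filtration_stratum_iff[OF A a] by simp_all
  ultimately show "i + j < k" by linarith
next
  assume "i + j < k"
  then show "(b, a) \<in> product_filtration m B n A k"
    unfolding product_filtration_def using a b by (intro UN_I[of "(Suc j, Suc i)"]) auto
qed

lemma closedin_product_filtration:
  assumes B: "closed_filtration X m B" and A: "closed_filtration Y n A"
  shows "closedin (prod_topology X Y) (product_filtration m B n A k)"
  unfolding product_filtration_def
proof (rule closedin_Union)
  show "finite ((\<lambda>(j, i). B j \<times> A i) ` {(j, i). j \<le> m \<and> i \<le> n \<and> i + j \<le> Suc k})"
    by (intro finite_imageI) (rule finite_subset[rotated, of "{..m} \<times> {..n}"], auto)
qed (use A B in \<open>auto simp: closed_filtration_def closedin_prod_Times_iff\<close>)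

lemma closed_filtration_product:
  assumes B: "closed_filtration X m B" and A: "closed_filtration Y n A"
    and "0 < m" "0 < n"
  shows "closed_filtration (prod_topology X Y) (m + n - 1) (product_filtration m B n A)"
proof -
  let ?Q = "product_filtration m B n A"
  have "?Q 0 = {}"
  proof -
    have "B j \<times> A i = {}" if "i + j \<le> Suc 0" for i j
      using that A B by (cases i; cases j) (auto simp: closed_filtration_def)
    then show ?thesis by (auto simp: product_filtration_def)
  qed
  moreover have "?Q (m + n - 1) = topspace (prod_topology X Y)"
  proof
    show "?Q (m + n - 1) \<subseteq> topspace (prod_topology X Y)"
      using closedin_subset[OF closedin_product_filtration[OF B A]] .
    show "topspace (prod_topology X Y) \<subseteq> ?Q (m + n - 1)"
      using A B \<open>0 < m\<close>
      unfolding product_filtration_def closed_filtration_def by (intro subsetI UN_I[of "(m, n)"]) auto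
  qed
  moreover have "?Q k \<subseteq> ?Q (Suc k)" for k
    by (fastforce simp: product_filtration_def)
  ultimately show ?thesis
    using closedin_product_filtration[OF B A] by (auto simp: closed_filtration_def)
qed

text \<open>
  A pair with \<open>b\<close> in stratum \<open>j\<close> and \<open>a\<close> in stratum \<open>i\<close> enters the product filtration at step
  \<open>i + j + 1\<close>. Within the stratum \<open>i + j = k\<close>, membership in the closed set \<open>B (Suc j) \<times> A (Suc i)\<close>
  bounds both indices from above, and their sum being fixed, it determines them; so the pieces are
  relatively closed.
\<close>

lemma product_filtration_stratum:
  assumes B: "closed_filtration X m B" and A: "closed_filtration Y n A"
  defines "S \<equiv> \<lambda>(j, i). (B (Suc j) - B j) \<times> (A (Suc i) - A i)"
    and "T \<equiv> \<lambda>k. product_filtration m B n A (Suc k) - product_filtration m B n A k"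
  shows "T k = (\<Union>q\<in>{(j, i). j < m \<and> i < n \<and> i + j = k}. S q)"
    and "\<lbrakk>j < m; i < n; i + j = k\<rbrakk> \<Longrightarrow> closedin (subtopology (prod_topology X Y) (T k)) (S (j, i))"
proof -
  let ?Q = "product_filtration m B n A"
  have sub: "?Q k \<subseteq> topspace (prod_topology X Y)" for k
    using closedin_subset[OF closedin_product_filtration[OF B A]] .
  show T: "T k = (\<Union>q\<in>{(j, i). j < m \<and> i < n \<and> i + j = k}. S q)"
  proof (intro set_eqI iffI)
    fix z assume z: "z \<in> T k"
    then have "fst z \<in> topspace X" "snd z \<in> topspace Y"
      using sub[of "Suc k"] by (auto simp: T_def)
    obtain j where "j < m" "fst z \<in> B (Suc j) - B j"
      using filtration_stratum[OF B \<open>fst z \<in> topspace X\<close>] .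
    moreover obtain i where "i < n" "snd z \<in> A (Suc i) - A i"
      using filtration_stratum[OF A \<open>snd z \<in> topspace Y\<close>] .
    moreover from calculation this have "i + j = k"
      using z in_product_filtration_iff[OF B A, of j "fst z" i "snd z"] by (auto simp: T_def)
    ultimately show "z \<in> (\<Union>q\<in>{(j, i). j < m \<and> i < n \<and> i + j = k}. S q)"
      by (intro UN_I[of "(j, i)"]) (auto simp: S_def mem_Times_iff)
  next
    fix z assume "z \<in> (\<Union>q\<in>{(j, i). j < m \<and> i < n \<and> i + j = k}. S q)"
    then show "z \<in> T k"
      using in_product_filtration_iff[OF B A] by (force simp: S_def T_def)
  qed
  assume ji: "j < m" "i < n" "i + j = k"
  have "closedin (prod_topology X Y) (B (Suc j) \<times> A (Suc i))"
    using A B ji by (auto simp: closed_filtration_def closedin_prod_Times_iff)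
  moreover have "S (j, i) = B (Suc j) \<times> A (Suc i) \<inter> T k"
  proof
    show "S (j, i) \<subseteq> B (Suc j) \<times> A (Suc i) \<inter> T k"
      unfolding T using ji by (auto simp: S_def)
    show "B (Suc j) \<times> A (Suc i) \<inter> T k \<subseteq> S (j, i)"
    proof
      fix z assume z: "z \<in> B (Suc j) \<times> A (Suc i) \<inter> T k"
      then obtain j' i' where ji': "j' < m" "i' < n" "i' + j' = k" and z': "z \<in> S (j', i')"
        unfolding T by auto
      have "j' < Suc j" "i' < Suc i"
        using filtration_stratum_iff[OF B ji'(1), of "fst z" "Suc j"]
          filtration_stratum_iff[OF A ji'(2), of "snd z" "Suc i"] z z' ji by (auto simp: S_def)
      then have "j' = j" "i' = i" using ji ji' by auto
      then show "z \<in> S (j, i)" using z' by simp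
    qed
  qed
  ultimately show "closedin (subtopology (prod_topology X Y) (T k)) (S (j, i))"
    by (auto simp: closedin_subtopology)
qed

section \<open>The upper bound for the topological complexity\<close>

text \<open>
  Disjoint pieces impose no compatibility condition on their sections, and finitely many relatively
  closed pieces glue to a continuous map.
\<close>

lemma partial_section_disjoint_closed_union:
  assumes fin: "finite I" and T: "T = (\<Union>i\<in>I. S i)" and TB: "T \<subseteq> topspace B"
    and dis: "\<And>i j. \<lbrakk>i \<in> I; j \<in> I; i \<noteq> j\<rbrakk> \<Longrightarrow> S i \<inter> S j = {}"
    and clo: "\<And>i. i \<in> I \<Longrightarrow> closedin (subtopology B T) (S i)"
    and sec: "\<And>i. i \<in> I \<Longrightarrow> \<exists>s. partial_section E B p (S i) s"
  shows "\<exists>s. partial_section E B p T s"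
proof -
  obtain s where s: "\<And>i. i \<in> I \<Longrightarrow> partial_section E B p (S i) (s i)"
    using sec by metis
  obtain t where t: "continuous_map (subtopology B T) E t"
    and ts: "\<And>x i. \<lbrakk>i \<in> I; x \<in> topspace (subtopology B T) \<inter> S i\<rbrakk> \<Longrightarrow> t x = s i x"
  proof (rule pasting_lemma_exists_closed[OF fin, of "subtopology B T" S E s])
    show "continuous_map (subtopology (subtopology B T) (S i)) E (s i)" if "i \<in> I" for i
    proof -
      have "T \<inter> S i = S i" using T that by blast
      then show ?thesis using s[OF that] by (simp add: subtopology_subtopology partial_section_def)
    qed
    show "s i x = s j x" if "i \<in> I" "j \<in> I" "x \<in> topspace (subtopology B T) \<inter> S i \<inter> S j" for i j x
      using that dis by (cases "i = j") auto
  qed (use T clo in auto)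
  have "p (t b) = b" if "b \<in> T" for b
  proof -
    have "\<exists>i\<in>I. b \<in> S i" using that unfolding T by simp
    then obtain i where i: "i \<in> I" "b \<in> S i" ..
    then have "t b = s i b" using ts that TB by auto
    then show ?thesis using s[OF i(1)] i(2) by (simp add: partial_section_def)
  qed
  then show ?thesis using t TB by (auto simp: partial_section_def)
qed

text \<open>
  The path from \<open>b\<close> to \<open>s a\<close> follows the contraction of \<open>E\<close> to a point \<open>c\<close> and then the reversed
  contraction of \<open>s ` A\<close> to \<open>c\<close>.
\<close>

lemma path_section_over_product:
  assumes C: "path_connected_space C" "topspace C \<noteq> {}"
    and E: "contractible_within C E" and s: "categorical_section C W f A s"
  shows "\<exists>\<sigma>. partial_section (path_space C) (prod_topology C W) (path_fibration f) (E \<times> A) \<sigma>"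
proof (rule iffD2[OF path_section_iff_homotopy])
  let ?X = "subtopology (prod_topology C W) (E \<times> A)"
  have EC: "E \<subseteq> topspace C" using E by (simp add: contractible_within_def)
  have AW: "A \<subseteq> topspace W" and sc: "continuous_map (subtopology W A) C s"
    and fs: "\<forall>w\<in>A. f (s w) = w" and sA: "contractible_within C (s ` A)"
    using s by (auto simp: categorical_section_def partial_section_def)
  show "E \<times> A \<subseteq> topspace (prod_topology C W)" using EC AW by auto
  obtain c where c: "c \<in> topspace C" using C(2) by blast
  have X: "?X = prod_topology (subtopology C E) (subtopology W A)"
    by (simp add: subtopology_Times)
  have 1: "continuous_map ?X (subtopology C E) fst"
    unfolding X by (rule continuous_map_fst)
  have h1: "homotopic_with (\<lambda>_. True) ?X C (id \<circ> fst) ((\<lambda>_. c) \<circ> fst)"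
    by (rule homotopic_with_compose_continuous_map_right[OF contractible_withinD[OF C(1) E c] 1]) auto
  have "continuous_map (subtopology W A) (subtopology C (s ` A)) s"
    using sc by (auto simp: continuous_map_in_subtopology)
  then have 2: "continuous_map ?X (subtopology C (s ` A)) (s \<circ> snd)"
    unfolding X by (rule continuous_map_compose[OF continuous_map_snd])
  have h2: "homotopic_with (\<lambda>_. True) ?X C (id \<circ> (s \<circ> snd)) ((\<lambda>_. c) \<circ> (s \<circ> snd))"
    by (rule homotopic_with_compose_continuous_map_right[OF contractible_withinD[OF C(1) sA c] 2]) auto
  have "homotopic_with (\<lambda>_. True) ?X C fst (s \<circ> snd)"
    using homotopic_with_trans[OF h1] homotopic_with_symD[OF h2] by (simp add: o_def)
  then show "\<exists>g. homotopic_with (\<lambda>_. True) ?X C fst g \<and> (\<forall>p\<in>E \<times> A. f (g p) = snd p)"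
    using fs by (intro exI[of _ "s \<circ> snd"]) auto
qed

lemma TC_le_of_filtrations:
  assumes C: "path_connected_space C" "topspace C \<noteq> {}" and "0 < m" "0 < n"
    and B: "closed_filtration C m B" and Bc: "\<And>j. j < m \<Longrightarrow> contractible_within C (B (Suc j) - B j)"
    and A: "closed_filtration W n A"
    and As: "\<And>i. i < n \<Longrightarrow> \<exists>s. categorical_section C W f (A (Suc i) - A i) s"
  shows "TC C W f \<le> enat (m + n - 1)"
proof -
  let ?Q = "product_filtration m B n A" and ?X = "prod_topology C W"
  have "\<exists>\<sigma>. partial_section (path_space C) ?X (path_fibration f) (?Q (Suc k) - ?Q k) \<sigma>" for k
  proof (rule partial_section_disjoint_closed_union[where I = "{(j, i). j < m \<and> i < n \<and> i + j = k}"
        and S = "\<lambda>(j, i). (B (Suc j) - B j) \<times> (A (Suc i) - A i)"])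
    have "finite ({..<m} \<times> {..<n})" by simp
    then show "finite {(j, i). j < m \<and> i < n \<and> i + j = k}"
      by (rule finite_subset[rotated]) auto
    show "?Q (Suc k) - ?Q k = (\<Union>q\<in>{(j, i). j < m \<and> i < n \<and> i + j = k}.
        (\<lambda>(j, i). (B (Suc j) - B j) \<times> (A (Suc i) - A i)) q)"
      by (rule product_filtration_stratum(1)[OF B A])
    show "?Q (Suc k) - ?Q k \<subseteq> topspace ?X"
      using closedin_subset[OF closedin_product_filtration[OF B A]] by blast
  next
    fix q r assume "q \<in> {(j, i). j < m \<and> i < n \<and> i + j = k}" "r \<in> {(j, i). j < m \<and> i < n \<and> i + j = k}"
    moreover assume "q \<noteq> r"
    ultimately obtain j i j' i' where q: "q = (j, i)" "j < m" and r: "r = (j', i')" "j' < m" and "j \<noteq> j'"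
      by (cases q; cases r) auto
    then have "(B (Suc j) - B j) \<inter> (B (Suc j') - B j') = {}"
      using filtration_strata_disjoint[OF B] by blast
    then show "(\<lambda>(j, i). (B (Suc j) - B j) \<times> (A (Suc i) - A i)) q \<inter>
        (\<lambda>(j, i). (B (Suc j) - B j) \<times> (A (Suc i) - A i)) r = {}"
      unfolding q(1) r(1) by auto
  next
    fix q assume "q \<in> {(j, i). j < m \<and> i < n \<and> i + j = k}"
    then obtain j i where q: "q = (j, i)" "j < m" "i < n" "i + j = k" by blast
    show "closedin (subtopology ?X (?Q (Suc k) - ?Q k)) ((\<lambda>(j, i). (B (Suc j) - B j) \<times> (A (Suc i) - A i)) q)"
      using product_filtration_stratum(2)[OF B A q(2-4)] q(1) by simp
    show "\<exists>\<sigma>. partial_section (path_space C) ?X (path_fibration f)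
        ((\<lambda>(j, i). (B (Suc j) - B j) \<times> (A (Suc i) - A i)) q) \<sigma>"
      using path_section_over_product[OF C Bc[OF q(2)]] As[OF q(3)] q(1) by auto
  qed
  then show ?thesis
    unfolding TC_def using closed_filtration_product[OF B A \<open>0 < m\<close> \<open>0 < n\<close>]
    by (intro Inf_lower) blast
qed

lemma enat_Inf_attained:
  fixes X :: "enat set"
  assumes "Inf X = enat n"
  shows "enat n \<in> X"
proof -
  have "X \<noteq> {}" using assms by (auto simp: Inf_enat_def)
  then show ?thesis using assms wellorder_InfI by (metis ex_in_conv)
qed

text \<open>
  Nonempty spaces have filtrations and covers of positive length only, so the subtraction of 1 does
  not truncate.
\<close>

lemma TC_le_csec_plus_cat:
  assumes C: "path_connected_space C" "topspace C \<noteq> {}" and W: "topspace W \<noteq> {}"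
  shows "TC C W f \<le> csec C W f + LS_cat C - 1"
proof (cases "csec C W f = \<infinity> \<or> LS_cat C = \<infinity>")
  case True
  then show ?thesis by auto
next
  case False
  then obtain n m where n: "csec C W f = enat n" and m: "LS_cat C = enat m" by auto
  obtain A where A: "closed_filtration W n A"
    and As: "\<forall>i<n. \<exists>s. categorical_section C W f (A (Suc i) - A i) s"
    using enat_Inf_attained[OF n[unfolded csec_def]] by auto
  obtain U where U: "\<forall>j<m. openin C (U j) \<and> contractible_within C (U j)" "(\<Union>j<m. U j) = topspace C"
    using enat_Inf_attained[OF m[unfolded LS_cat_def]] by auto
  have "\<And>j. j < m \<Longrightarrow> openin C (U j)" using U(1) by blast
  from closed_filtration_from_open_cover[OF this U(2)]
  obtain B where B: "closed_filtration C m B" "\<forall>j<m. B (Suc j) - B j \<subseteq> U j" .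
  have "contractible_within C (B (Suc j) - B j)" if "j < m" for j
    using contractible_within_subset B(2) U(1) that by blast
  moreover have "0 < m" using U(2) C(2) by (cases m) auto
  moreover have "0 < n" using A W by (cases n) (auto simp: closed_filtration_def)
  ultimately have "TC C W f \<le> enat (m + n - 1)"
    using TC_le_of_filtrations[OF C _ _ B(1) _ A] As by blast
  then show ?thesis
    by (simp add: n m one_enat_def add.commute)
qed

section \<open>Equicontinuous extension in metric spaces\<close>

text \<open>
  The outer absolute value makes the function nonnegative on all arguments, also where the supremum is
  taken of an unbounded set and therefore unspecified; for bounded functions it changes nothing.
\<close>

definition sup_dist :: "('s \<Rightarrow> real) \<Rightarrow> ('s \<Rightarrow> real) \<Rightarrow> real" where
  "sup_dist \<phi> \<psi> = \<bar>SUP s. \<bar>\<phi> s - \<psi> s\<bar>\<bar>"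

lemma sup_dist_le_iff:
  assumes "bounded (range \<phi>)" "bounded (range \<psi>)"
  shows "sup_dist \<phi> \<psi> \<le> e \<longleftrightarrow> (\<forall>s. \<bar>\<phi> s - \<psi> s\<bar> \<le> e)"
proof -
  obtain a b where "\<And>s. \<bar>\<phi> s\<bar> \<le> a" "\<And>s. \<bar>\<psi> s\<bar> \<le> b"
    using assms unfolding bounded_iff by auto
  then have "\<bar>\<phi> s - \<psi> s\<bar> \<le> a + b" for s
    using abs_triangle_ineq4[of "\<phi> s" "\<psi> s"] add_mono order_trans by blast
  then have bdd: "bdd_above (range (\<lambda>s. \<bar>\<phi> s - \<psi> s\<bar>))"
    by (intro bdd_aboveI[of _ "a + b"]) auto
  have "0 \<le> (SUP s. \<bar>\<phi> s - \<psi> s\<bar>)"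
    using cSUP_upper[OF UNIV_I bdd] abs_ge_zero order_trans by blast
  then show ?thesis
    using cSUP_le_iff[OF _ bdd, of e] by (simp add: sup_dist_def)
qed

lemma sup_dist_upper:
  assumes "bounded (range \<phi>)" "bounded (range \<psi>)"
  shows "\<bar>\<phi> s - \<psi> s\<bar> \<le> sup_dist \<phi> \<psi>"
  using sup_dist_le_iff[OF assms] by blast

lemma Metric_space_sup_dist: "Metric_space {\<phi>. bounded (range \<phi>)} sup_dist"
proof
  fix \<phi> \<psi> \<theta> :: "'a \<Rightarrow> real"
  show "0 \<le> sup_dist \<phi> \<psi>" "sup_dist \<phi> \<psi> = sup_dist \<psi> \<phi>"
    by (simp_all add: sup_dist_def abs_minus_commute)
  assume "\<phi> \<in> {\<phi>. bounded (range \<phi>)}" and "\<psi> \<in> {\<phi>. bounded (range \<phi>)}"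
  then have b: "bounded (range \<phi>)" "bounded (range \<psi>)" by auto
  show "sup_dist \<phi> \<psi> = 0 \<longleftrightarrow> \<phi> = \<psi>"
  proof
    assume "sup_dist \<phi> \<psi> = 0"
    then have "\<forall>s. \<bar>\<phi> s - \<psi> s\<bar> \<le> 0"
      using sup_dist_le_iff[OF b] by (metis order_refl)
    then show "\<phi> = \<psi>" by (auto intro!: ext)
  qed (simp add: sup_dist_def)
  assume "\<theta> \<in> {\<phi>. bounded (range \<phi>)}"
  then have c: "bounded (range \<theta>)" by auto
  have "\<bar>\<phi> s - \<theta> s\<bar> \<le> sup_dist \<phi> \<psi> + sup_dist \<psi> \<theta>" for s
    using sup_dist_upper[OF b, of s] sup_dist_upper[OF b(2) c, of s] by linarith
  then show "sup_dist \<phi> \<theta> \<le> sup_dist \<phi> \<psi> + sup_dist \<psi> \<theta>"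
    using sup_dist_le_iff[OF b(1) c] by blast
qed

context Metric_space
begin

definition distance_to :: "'a set \<Rightarrow> 'a \<Rightarrow> real" where
  "distance_to A z = (INF a\<in>A. d z a)"

lemma bdd_below_distances: "bdd_below ((\<lambda>a. d z a) ` A)"
  by (rule bdd_belowI[of _ 0]) auto

lemma distance_to_le: "a \<in> A \<Longrightarrow> distance_to A z \<le> d z a"
  unfolding distance_to_def by (rule cINF_lower[OF bdd_below_distances])

lemma distance_to_nonneg: "A \<noteq> {} \<Longrightarrow> 0 \<le> distance_to A z"
  unfolding distance_to_def by (rule cINF_greatest) auto

lemma distance_to_less:
  "A \<noteq> {} \<Longrightarrow> distance_to A z < e \<Longrightarrow> \<exists>a\<in>A. d z a < e"
  unfolding distance_to_def by (subst (asm) cINF_less_iff) (auto simp: bdd_below_distances)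

lemma distance_to_Lipschitz:
  assumes "A \<subseteq> M" "A \<noteq> {}" "y \<in> M" "z \<in> M"
  shows "\<bar>distance_to A y - distance_to A z\<bar> \<le> d y z"
proof -
  have "distance_to A u - d u v \<le> distance_to A v" if "u \<in> M" "v \<in> M" for u v
    unfolding distance_to_def[of A v]
  proof (rule cINF_greatest[OF assms(2)])
    fix a assume a: "a \<in> A"
    then have "d u a \<le> d u v + d v a"
      using assms(1) that by (intro triangle) auto
    then show "distance_to A u - d u v \<le> d v a"
      using distance_to_le[OF a, of u] by linarith
  qed
  from this[of y z] this[of z y] show ?thesis
    using assms commute[of y z] by linarith
qed

lemma distance_to_eq_0:
  assumes "A \<subseteq> M" "z \<in> A"
  shows "distance_to A z = 0"
proof -
  have "d z z = 0" using assms by auto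
  then show ?thesis
    using distance_to_le[OF assms(2), of z] distance_to_nonneg[of A z] assms(2) by auto
qed

lemma distance_to_pos:
  assumes A: "closedin mtopology A" "A \<noteq> {}" and z: "z \<in> M" "z \<notin> A"
  shows "0 < distance_to A z"
proof -
  have "openin mtopology (M - A)"
    using A(1) by (simp add: closedin_def)
  then obtain r where r: "r > 0" "mball z r \<subseteq> M - A"
    using z unfolding openin_mtopology by blast
  have "r \<le> d z a" if "a \<in> A" for a
  proof (rule ccontr)
    assume "\<not> r \<le> d z a"
    moreover have "a \<in> M" using A(1) closedin_subset that by fastforce
    ultimately have "a \<in> mball z r" using z by simp
    then show False using r that by auto
  qed
  then have "r \<le> distance_to A z"
    unfolding distance_to_def using A(2) by (intro cINF_greatest) auto
  then show ?thesis using r by linarith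
qed

text \<open>
  For \<open>z\<close> at positive distance \<open>\<delta>\<close> from \<open>A\<close>, this weight is 1 if \<open>a\<close> is at most \<open>2 * \<delta>\<close> away from
  \<open>z\<close> and 0 if it is at least \<open>3 * \<delta>\<close> away.
\<close>

definition nearness :: "'a set \<Rightarrow> 'a \<Rightarrow> 'a \<Rightarrow> real" where
  "nearness A z a = max 0 (min 1 (3 - d z a / distance_to A z))"

lemma nearness_bounds: "0 \<le> nearness A z a" "nearness A z a \<le> 1"
  by (auto simp: nearness_def)

text \<open>
  The Lipschitz constant does not depend on \<open>a\<close>: where the weight is not locally zero, the quotient
  that defines it is at most 3, so distant points \<open>a\<close> contribute nothing.
\<close>

lemma nearness_locally_Lipschitz:
  assumes A: "A \<subseteq> M" "a \<in> A" and yz: "y \<in> M" "z \<in> M"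
    and pos: "0 < r" "r \<le> distance_to A y" "r \<le> distance_to A z"
  shows "\<bar>nearness A y a - nearness A z a\<bar> \<le> 4 * d y z / r"
proof -
  have main: "\<bar>nearness A y a - nearness A z a\<bar> \<le> 4 * d y z / r"
    if yz: "y \<in> M" "z \<in> M" and pos: "r \<le> distance_to A y" "r \<le> distance_to A z"
      and le: "d y a / distance_to A y \<le> 3" for y z
  proof -
    let ?D = "distance_to A"
    define u where "u = d y a / ?D y"
    have u: "0 \<le> u" "u \<le> 3" "d y a = u * ?D y"
      using le pos \<open>0 < r\<close> by (auto simp: u_def)
    have "\<bar>nearness A y a - nearness A z a\<bar> \<le> \<bar>u - d z a / ?D z\<bar>"
      unfolding nearness_def u_def by linarith
    also have "u - d z a / ?D z = (u * (?D z - ?D y) + (d y a - d z a)) / ?D z"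
      using pos \<open>0 < r\<close> u(3) by (simp add: field_simps)
    also have "\<bar>\<dots>\<bar> = \<bar>u * (?D z - ?D y) + (d y a - d z a)\<bar> / ?D z"
      using pos \<open>0 < r\<close> by simp
    also have "\<dots> \<le> (4 * d y z) / ?D z"
    proof (rule divide_right_mono)
      have 1: "\<bar>?D z - ?D y\<bar> \<le> d y z"
        using distance_to_Lipschitz[OF A(1) _ yz(2) yz(1)] A(2) commute[of y z] by auto
      have "\<bar>u * (?D z - ?D y)\<bar> \<le> 3 * d y z"
        unfolding abs_mult using u 1 by (intro mult_mono) auto
      moreover have "\<bar>d y a - d z a\<bar> \<le> d y z"
        using mdist_reverse_triangle[of y a z] commute[of z a] yz A by auto
      ultimately show "\<bar>u * (?D z - ?D y) + (d y a - d z a)\<bar> \<le> 4 * d y z"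
        by linarith
    qed (use pos \<open>0 < r\<close> in auto)
    also have "\<dots> \<le> 4 * d y z / r"
      using pos \<open>0 < r\<close> by (intro divide_left_mono) auto
    finally show ?thesis .
  qed
  consider "d y a / distance_to A y \<le> 3" | "d z a / distance_to A z \<le> 3"
    | "d y a / distance_to A y > 3" "d z a / distance_to A z > 3" by linarith
  then show ?thesis
  proof cases
    case 1
    then show ?thesis using main yz pos by blast
  next
    case 2
    then show ?thesis using main[of z y] yz pos commute[of y z] by (simp add: abs_minus_commute)
  next
    case 3
    then have "nearness A y a = 0" "nearness A z a = 0" by (auto simp: nearness_def)
    then show ?thesis using pos by simp
  qed
qed

text \<open>
  This is a Tietze-type theorem that is uniform in a parameter \<open>s\<close> of an arbitrary type. Off \<open>A\<close>, let
  \<open>P z s\<close> be the supremum over \<open>a \<in> A\<close> of \<open>p a s\<close> times the nearness of \<open>a\<close> to \<open>z\<close>. Off \<open>A\<close> it is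
  equicontinuous since the weights are equicontinuous and the values are bounded by 1. As \<open>z\<close>
  approaches \<open>a\<^sub>0 \<in> A\<close>, only points near \<open>a\<^sub>0\<close> have positive weight and some of them have weight 1, so
  \<open>P z s\<close> approaches \<open>p a\<^sub>0 s\<close> at a rate independent of \<open>s\<close>.
\<close>

proposition equicontinuous_extension:
  fixes p :: "'a \<Rightarrow> 's \<Rightarrow> real"
  assumes A: "closedin mtopology A" "A \<noteq> {}"
    and p01: "\<And>a s. a \<in> A \<Longrightarrow> 0 \<le> p a s \<and> p a s \<le> 1"
    and cont: "\<And>a \<epsilon>. \<lbrakk>a \<in> A; 0 < \<epsilon>\<rbrakk> \<Longrightarrow>
      \<exists>\<delta>>0. \<forall>b\<in>A. d a b < \<delta> \<longrightarrow> (\<forall>s. \<bar>p a s - p b s\<bar> \<le> \<epsilon>)"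
  obtains P where "\<And>a. a \<in> A \<Longrightarrow> P a = p a"
    and "\<And>z s. 0 \<le> P z s \<and> P z s \<le> 1"
    and "\<And>z \<epsilon>. \<lbrakk>z \<in> M; 0 < \<epsilon>\<rbrakk> \<Longrightarrow>
      \<exists>\<delta>>0. \<forall>y\<in>M. d z y < \<delta> \<longrightarrow> (\<forall>s. \<bar>P z s - P y s\<bar> \<le> \<epsilon>)"
proof -
  let ?D = "distance_to A" and ?w = "nearness A"
  define F where "F z s = (SUP a\<in>A. ?w z a * p a s)" for z s
  define P where "P z = (if z \<in> A then p z else F z)" for z
  have AM: "A \<subseteq> M" using A(1) closedin_subset by fastforce
  have term_bounds: "0 \<le> ?w z a * p a s" "?w z a * p a s \<le> 1" "?w z a * p a s \<le> p a s"
    if "a \<in> A" for z a s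
    using p01[OF that, of s] nearness_bounds[of A z a]
    by (auto intro: mult_le_one mult_left_le_one_le)
  have F_upper: "?w z a * p a s \<le> F z s" if "a \<in> A" for z a s
    unfolding F_def using that term_bounds(2) by (intro cSUP_upper bdd_aboveI[of _ 1]) auto
  have F_least: "F z s \<le> e" if "\<And>a. a \<in> A \<Longrightarrow> ?w z a * p a s \<le> e" for z s e
    unfolding F_def using that A(2) by (intro cSUP_least) auto
  have "0 \<le> F z s \<and> F z s \<le> 1" for z s
  proof -
    obtain a where "a \<in> A" using A(2) by blast
    then show ?thesis
      using F_upper[of a z s] term_bounds(1)[of a z s] F_least[OF term_bounds(2)] by force
  qed
  then have "0 \<le> P z s \<and> P z s \<le> 1" for z s
    using p01 by (simp add: P_def)
  moreover have "\<exists>\<delta>>0. \<forall>y\<in>M. d z y < \<delta> \<longrightarrow> (\<forall>s. \<bar>P z s - P y s\<bar> \<le> \<epsilon>)"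
    if z: "z \<in> M" and \<epsilon>: "0 < \<epsilon>" for z \<epsilon>
  proof (cases "z \<in> A")
    case True
    then obtain \<delta> where \<delta>: "0 < \<delta>"
      and near: "\<And>b s. \<lbrakk>b \<in> A; d z b < \<delta>\<rbrakk> \<Longrightarrow> \<bar>p z s - p b s\<bar> \<le> \<epsilon>"
      using cont[OF True \<epsilon>] by blast
    \<comment> \<open>A point \<open>a\<close> of positive weight satisfies \<open>d y a < 3 * d y z\<close>, so \<open>d z a < 4 * d z y\<close>; hence the
      factor 4.\<close>
    have "\<bar>P z s - P y s\<bar> \<le> \<epsilon>" if y: "y \<in> M" and dist: "d z y < \<delta> / 4" for y s
    proof (cases "y \<in> A")
      case yA: True
      then show ?thesis using near[of y s] True dist \<delta> by (simp add: P_def)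
    next
      case False
      have Dpos: "0 < ?D y" using distance_to_pos[OF A y False] .
      have close: "\<bar>p z s - p a s\<bar> \<le> \<epsilon>" if a: "a \<in> A" "d y a < 3 * ?D y" for a
      proof (rule near[OF a(1)])
        have "?D y \<le> d z y" using distance_to_le[OF True, of y] commute[of y z] by simp
        moreover have "d z a \<le> d z y + d y a"
          using z y AM a by (intro triangle) auto
        ultimately show "d z a < \<delta>" using a dist by linarith
      qed
      have "F y s \<le> p z s + \<epsilon>"
      proof (rule F_least)
        fix a assume a: "a \<in> A"
        show "?w y a * p a s \<le> p z s + \<epsilon>"
        proof (cases "d y a < 3 * ?D y")
          case True
          then show ?thesis using close[OF a True] term_bounds(3)[OF a, of y s] by linarith
        next
          case False
          then have "?w y a = 0" using Dpos by (simp add: nearness_def field_simps)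
          then show ?thesis using p01[OF True, of s] \<epsilon> by simp
        qed
      qed
      moreover have "p z s - \<epsilon> \<le> F y s"
      proof -
        obtain a where a: "a \<in> A" "d y a < 2 * ?D y"
          using distance_to_less[OF A(2), of y "2 * ?D y"] Dpos by auto
        then have "?w y a = 1" using Dpos by (simp add: nearness_def field_simps)
        then show ?thesis
          using F_upper[OF a(1), of y s] close[OF a(1)] a(2) Dpos by auto
      qed
      ultimately show ?thesis using True False by (simp add: P_def abs_le_iff)
    qed
    then show ?thesis using \<delta> by (intro exI[of _ "\<delta> / 4"]) auto
  next
    case False
    have Dpos: "0 < ?D z" using distance_to_pos[OF A z False] .
    \<comment> \<open>The first bound keeps the distance to \<open>A\<close> above half its value at \<open>z\<close>; the second one is then
      \<open>\<epsilon>\<close> divided by the Lipschitz constant of the weights.\<close>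
    define \<delta> where "\<delta> = min (?D z / 2) (\<epsilon> * ?D z / 8)"
    have "\<bar>P z s - P y s\<bar> \<le> \<epsilon>" if y: "y \<in> M" and dist: "d z y < \<delta>" for y s
    proof -
      have Dy: "?D z / 2 \<le> ?D y"
        using distance_to_Lipschitz[OF AM A(2) z y] dist by (simp add: \<delta>_def abs_le_iff)
      then have yA: "y \<notin> A" using distance_to_eq_0[OF AM] Dpos by force
      have w: "\<bar>?w z a - ?w y a\<bar> \<le> \<epsilon>" if "a \<in> A" for a
      proof -
        have "\<bar>?w z a - ?w y a\<bar> \<le> 4 * d z y / (?D z / 2)"
          using nearness_locally_Lipschitz[OF AM that z y, of "?D z / 2"] Dpos Dy by simp
        also have "\<dots> \<le> \<epsilon>"
          using dist Dpos by (simp add: \<delta>_def field_simps)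
        finally show ?thesis .
      qed
      have le: "F u s \<le> F v s + \<epsilon>" if "\<And>a. a \<in> A \<Longrightarrow> \<bar>?w u a - ?w v a\<bar> \<le> \<epsilon>" for u v
      proof (rule F_least)
        fix a assume a: "a \<in> A"
        have "(?w u a - ?w v a) * p a s \<le> \<epsilon> * p a s"
          using that[OF a] p01[OF a, of s] by (intro mult_right_mono) (auto simp: abs_le_iff)
        also have "\<dots> \<le> \<epsilon> * 1"
          using p01[OF a, of s] \<epsilon> by (intro mult_left_mono) auto
        finally have "(?w u a - ?w v a) * p a s \<le> \<epsilon>" by simp
        then show "?w u a * p a s \<le> F v s + \<epsilon>"
          using F_upper[OF a, of v s] by (simp add: algebra_simps)
      qed
      have "F z s \<le> F y s + \<epsilon>" "F y s \<le> F z s + \<epsilon>"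
        using le[of z y] le[of y z] w by (auto simp: abs_minus_commute)
      then show ?thesis using False yA by (simp add: P_def abs_le_iff)
    qed
    moreover have "0 < \<delta>" using Dpos \<epsilon> by (simp add: \<delta>_def)
    ultimately show ?thesis by blast
  qed
  ultimately show ?thesis
    using that[of P] by (simp add: P_def)
qed

end

section \<open>Metric ANR spaces\<close>

text \<open>
  Metric ANR spaces are absolute neighbourhood extensors for metrizable spaces. The universal space
  for such extension problems is \<open>Y\<close>, the Kuratowski image of \<open>W\<close> together with the set \<open>Q\<close> of
  bounded functions with positive infimum: \<open>W\<close> is closed in \<open>Y\<close> although it need not be closed in the
  space of all bounded functions, and every map from a closed subset \<open>A\<close> of \<open>Z\<close> to \<open>W\<close> extends to a
  map from \<open>Z\<close> to \<open>Y\<close>.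
\<close>

proposition metric_ANR_neighbourhood_extension:
  fixes W :: "'w topology"
  assumes anr: "metric_ANR_space W" and Z: "metrizable_space Z" and A: "closedin Z A"
    and g: "continuous_map (subtopology Z A) W g"
  obtains N h where "openin Z N" "A \<subseteq> N" "continuous_map (subtopology Z N) W h"
    "\<And>a. a \<in> A \<Longrightarrow> h a = g a"
proof (cases "A = {}")
  case True
  then show ?thesis using that[of "{}" g] g by auto
next
  case False
  obtain M d' where "Metric_space M d'" and W': "W = Metric_space.mtopology M d'"
    using anr by (auto simp: metric_ANR_space_def metrizable_space_def)
  then interpret W': Metric_space M d' by simp
  define d where "d = W'.capped_dist 1"
  interpret W: Metric_space M d unfolding d_def by (rule W'.capped_dist)
  have W: "W = W.mtopology"
    using W'.mtopology_capped_metric[of 1] by (simp add: d_def W')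
  have d1: "d x y \<le> 1" for x y by (simp add: d_def W'.capped_dist_def)
  obtain L \<rho> where "Metric_space L \<rho>" and Zm: "Z = Metric_space.mtopology L \<rho>"
    using Z by (auto simp: metrizable_space_def)
  then interpret Z: Metric_space L \<rho> by simp
  have AL: "A \<subseteq> L" using closedin_subset[OF A] by (simp add: Zm)
  have gM: "g a \<in> M" if "a \<in> A" for a
    using continuous_map_image_subset_topspace[OF g] that AL by (auto simp: W Zm)

  \<comment> \<open>The value 1 off \<open>M\<close> bounds \<open>d\<close>, so the infimum of \<open>\<kappa> w\<close> is attained at \<open>w\<close>, where it is 0.\<close>
  define \<kappa> where "\<kappa> w s = (if s \<in> M then d w s else 1)" for w s
  have \<kappa>01: "0 \<le> \<kappa> w s \<and> \<kappa> w s \<le> 1" for w s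
    using d1 by (simp add: \<kappa>_def)
  have b\<kappa>: "bounded (range (\<kappa> w))" for w
    using \<kappa>01[of w] unfolding bounded_iff by (intro exI[of _ 1]) auto
  have \<kappa>_nonexp: "\<bar>\<kappa> w s - \<kappa> v s\<bar> \<le> d w v" if "w \<in> M" "v \<in> M" for w v s
    using that W.mdist_reverse_triangle[of w s v] W.commute by (auto simp: \<kappa>_def)
  have iso: "sup_dist (\<kappa> w) (\<kappa> v) = d w v" if "w \<in> M" "v \<in> M" for w v
  proof (rule antisym)
    show "sup_dist (\<kappa> w) (\<kappa> v) \<le> d w v"
      using sup_dist_le_iff[OF b\<kappa> b\<kappa>] \<kappa>_nonexp that by blast
    show "d w v \<le> sup_dist (\<kappa> w) (\<kappa> v)"
      using sup_dist_upper[OF b\<kappa> b\<kappa>, of w v v] that by (simp add: \<kappa>_def)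
  qed
  define Q where "Q = {\<psi> :: 'w \<Rightarrow> real. bounded (range \<psi>) \<and> (\<exists>r>0. \<forall>s. r \<le> \<psi> s)}"
  define Y where "Y = \<kappa> ` M \<union> Q"
  have bY: "bounded (range \<psi>)" if "\<psi> \<in> Y" for \<psi>
    using that b\<kappa> by (auto simp: Y_def Q_def)
  interpret Y: Metric_space Y sup_dist
    using Metric_space.subspace[OF Metric_space_sup_dist, of Y] bY by blast
  interpret WY: Metric_space12 M d Y sup_dist ..
  have emb: "embedding_map W Y.mtopology \<kappa>"
    unfolding W by (rule WY.isometry_imp_embedding_map) (auto simp: Y_def iso)
  have "openin Y.mtopology Q"
    unfolding Y.openin_mtopology
  proof (intro conjI allI impI)
    show "Q \<subseteq> Y" by (simp add: Y_def)
    fix \<psi> assume \<psi>: "\<psi> \<in> Q"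
    then obtain r where r: "r > 0" "\<And>s. r \<le> \<psi> s" by (auto simp: Q_def)
    have "\<theta> \<in> Q" if \<theta>: "\<theta> \<in> Y" "sup_dist \<psi> \<theta> < r / 2" for \<theta>
    proof -
      have "r / 2 \<le> \<theta> s" for s
        using sup_dist_upper[OF bY bY, of \<psi> \<theta> s] \<psi> \<theta> r(2)[of s]
        by (auto simp: Y_def abs_le_iff)
      then show ?thesis using r(1) bY[OF \<theta>(1)] by (auto simp: Q_def intro!: exI[of _ "r / 2"])
    qed
    then show "\<exists>r>0. Y.mball \<psi> r \<subseteq> Q"
      using r(1) by (intro exI[of _ "r / 2"]) auto
  qed
  moreover have "\<kappa> ` topspace W = topspace Y.mtopology - Q"
  proof -
    have "\<kappa> w \<notin> Q" if "w \<in> M" for w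
      using that W.mdist_zero[OF that] by (force simp: Q_def \<kappa>_def dest: spec[of _ w])
    then show ?thesis
      unfolding W W.topspace_mtopology Y.topspace_mtopology by (auto simp: Y_def)
  qed
  ultimately have "closedin Y.mtopology (\<kappa> ` topspace W)"
    by (simp add: closedin_diff)
  with emb anr Y.metrizable_space_mtopology
  obtain U where U: "openin Y.mtopology U" "\<kappa> ` topspace W \<subseteq> U"
    and "\<kappa> ` topspace W retract_of_space subtopology Y.mtopology U"
    unfolding metric_ANR_space_def by blast
  then obtain r where r: "continuous_map (subtopology Y.mtopology U)
        (subtopology Y.mtopology (\<kappa> ` topspace W)) r"
    and r_id: "\<And>\<psi>. \<psi> \<in> \<kappa> ` topspace W \<Longrightarrow> r \<psi> = \<psi>"
    by (auto simp: retract_of_space_def subtopology_subtopology inf.absorb2)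
  obtain k where k: "continuous_map (subtopology Y.mtopology (\<kappa> ` topspace W)) W k"
    and k\<kappa>: "\<And>w. w \<in> topspace W \<Longrightarrow> k (\<kappa> w) = w"
    using emb by (auto simp: embedding_map_def homeomorphic_map_maps homeomorphic_maps_def)

  have A': "closedin Z.mtopology A" using A by (simp add: Zm)
  have sub: "subtopology Z A = Metric_space.mtopology A \<rho>"
    using Submetric.mtopology_submetric[of L \<rho> A] AL Z.Metric_space_axioms
    by (simp add: Submetric_def Submetric_axioms_def Zm)
  have "\<exists>\<delta>>0. \<forall>b\<in>A. \<rho> a b < \<delta> \<longrightarrow> (\<forall>s. \<bar>\<kappa> (g a) s - \<kappa> (g b) s\<bar> \<le> \<epsilon>)"
    if a: "a \<in> A" and "0 < \<epsilon>" for a \<epsilon>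
  proof -
    have "\<exists>\<delta>>0. \<forall>b. b \<in> A \<and> \<rho> a b < \<delta> \<longrightarrow> d (g a) (g b) < \<epsilon>"
      using g Metric_space.metric_continuous_map[OF Z.subspace[OF AL] W.Metric_space_axioms] a \<open>0 < \<epsilon>\<close>
      unfolding sub W by blast
    then show ?thesis
      using \<kappa>_nonexp gM a by (meson less_imp_le order_trans)
  qed
  with \<kappa>01 obtain P where PA: "\<And>a. a \<in> A \<Longrightarrow> P a = \<kappa> (g a)"
    and P01: "\<And>z s. 0 \<le> P z s \<and> P z s \<le> 1"
    and Pc: "\<And>z \<epsilon>. \<lbrakk>z \<in> L; 0 < \<epsilon>\<rbrakk> \<Longrightarrow>
      \<exists>\<delta>>0. \<forall>y\<in>L. \<rho> z y < \<delta> \<longrightarrow> (\<forall>s. \<bar>P z s - P y s\<bar> \<le> \<epsilon>)"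
    using Z.equicontinuous_extension[OF A' False, of "\<lambda>a. \<kappa> (g a)"] by metis
  \<comment> \<open>The summand \<open>D\<close> vanishes exactly on \<open>A\<close> and pushes \<open>P z\<close> into \<open>Q\<close> elsewhere.\<close>
  define D where "D z = min 1 (Z.distance_to A z)" for z
  define G where "G z s = P z s + D z" for z s
  have D01: "0 \<le> D z" "D z \<le> 1" for z
    using Z.distance_to_nonneg[OF False] by (auto simp: D_def)
  have GA: "G a = \<kappa> (g a)" if "a \<in> A" for a
    using Z.distance_to_eq_0[OF AL that] PA[OF that] by (auto simp: G_def D_def)
  have bG: "bounded (range (G z))" for z
    unfolding bounded_iff
  proof (intro exI ballI)
    fix x assume "x \<in> range (G z)"
    then obtain s where "x = P z s + D z" by (auto simp: G_def)
    then show "norm x \<le> 2"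
      using P01[of z s] D01[of z] by simp
  qed
  have GY: "G z \<in> Y" if "z \<in> L" for z
  proof (cases "z \<in> A")
    case True
    then show ?thesis using GA gM by (auto simp: Y_def)
  next
    case zA: False
    then have "0 < D z" using Z.distance_to_pos[OF A' False that] by (simp add: D_def)
    moreover have "D z \<le> G z s" for s using P01[of z s] by (simp add: G_def)
    ultimately show ?thesis using bG[of z] by (auto simp: Y_def Q_def)
  qed
  have Gc: "continuous_map Z Y.mtopology G"
    unfolding Zm Z.metric_continuous_map[OF Y.Metric_space_axioms]
  proof (intro conjI ballI allI impI)
    show "G ` L \<subseteq> Y" using GY by blast
    fix z and \<epsilon> :: real assume z: "z \<in> L" and \<epsilon>: "0 < \<epsilon>"
    obtain \<delta> where \<delta>: "0 < \<delta>"
      and near: "\<And>y s. \<lbrakk>y \<in> L; \<rho> z y < \<delta>\<rbrakk> \<Longrightarrow> \<bar>P z s - P y s\<bar> \<le> \<epsilon> / 3"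
      using Pc[OF z, of "\<epsilon> / 3"] \<epsilon> by auto
    have "sup_dist (G z) (G y) < \<epsilon>" if y: "y \<in> L" and dist: "\<rho> z y < min \<delta> (\<epsilon> / 3)" for y
    proof -
      have "\<bar>D z - D y\<bar> \<le> \<epsilon> / 3"
        using Z.distance_to_Lipschitz[OF AL False z y] dist unfolding D_def by linarith
      then have "\<bar>G z s - G y s\<bar> \<le> 2 * \<epsilon> / 3" for s
        using near[OF y, of s] dist unfolding G_def by linarith
      then have "sup_dist (G z) (G y) \<le> 2 * \<epsilon> / 3"
        using sup_dist_le_iff[OF bG bG] by blast
      then show ?thesis using \<epsilon> by linarith
    qed
    then show "\<exists>\<delta>>0. \<forall>y. y \<in> L \<and> \<rho> z y < \<delta> \<longrightarrow> sup_dist (G z) (G y) < \<epsilon>"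
      using \<delta> \<epsilon> by (intro exI[of _ "min \<delta> (\<epsilon> / 3)"]) auto
  qed

  let ?N = "{z \<in> topspace Z. G z \<in> U}"
  show ?thesis
  proof
    show "openin Z ?N" using Gc U(1) by (rule openin_continuous_map_preimage)
    show "A \<subseteq> ?N"
      using GA gM U(2) AL by (auto simp: W Zm)
    have "continuous_map (subtopology Z ?N) (subtopology Y.mtopology U) G"
      using Gc by (auto simp: continuous_map_in_subtopology continuous_map_from_subtopology)
    then show "continuous_map (subtopology Z ?N) W (k \<circ> (r \<circ> G))"
      using r k by (blast intro: continuous_map_compose)
    show "(k \<circ> (r \<circ> G)) a = g a" if "a \<in> A" for a
      using GA[OF that] gM[OF that] r_id k\<kappa> by (simp add: W)
  qed
qed

text \<open>
  The contraction of \<open>S\<close> is extended together with its prescribed ends on all of \<open>V\<close>: the identity at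
  time 0 and the constant \<open>c\<close> at time 1. Prescribing the latter makes the extended homotopy end in a
  single point on the whole neighbourhood, not only on \<open>S\<close>. Compactness of the unit interval then
  gives a neighbourhood of \<open>S\<close> that does not depend on time.
\<close>

lemma metric_ANR_contractible_neighbourhood:
  fixes W :: "'w topology"
  assumes anr: "metric_ANR_space W" and V: "openin W V"
    and S: "closedin (subtopology W V) S" and con: "contractible_within W S"
  obtains V' where "openin W V'" "S \<subseteq> V'" "contractible_within W V'"
proof -
  let ?I = "top_of_set {0..1::real}"
  define Z where "Z = prod_topology ?I (subtopology W V)"
  define T where "T i = (if i = (0::nat) then {0} \<times> V else if i = 1 then {1} \<times> V else {0..1::real} \<times> S)" for i
  define A where "A = (\<Union>i<3. T i)"
  obtain c H where c: "c \<in> topspace W" and H: "continuous_map (prod_topology ?I (subtopology W S)) W H"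
    and H01: "\<And>x. H (0, x) = x" "\<And>x. H (1, x) = c"
    using con by (auto simp: contractible_within_def homotopic_with_def)
  have VW: "V \<subseteq> topspace W" and SV: "S \<subseteq> V"
    using V S openin_subset closedin_subset by fastforce+
  have tZ: "topspace Z = {0..1} \<times> V" using VW by (auto simp: Z_def)
  have Zmet: "metrizable_space Z"
    unfolding Z_def metrizable_space_prod_topology using anr
    by (auto simp: metric_ANR_space_def metrizable_space_euclidean metrizable_space_subtopology)
  have Tclosed: "closedin Z (T i)" for i
    using S VW unfolding Z_def T_def by (auto simp: closedin_prod_Times_iff closedin_subtopology_refl intro!: closed_subset)
  then have Aclosed: "closedin Z A" unfolding A_def by (intro closedin_Union) auto
  define f where "f i = (if i = (0::nat) then snd else if i = 1 then (\<lambda>_. c) else H)" for i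
  have fc: "continuous_map (subtopology Z (T i)) W (f i)" for i
  proof -
    consider "i = 0" | "i = 1" | "i \<noteq> 0" "i \<noteq> 1" by blast
    then show ?thesis
    proof cases
      case 1
      have "continuous_map Z W snd"
        unfolding Z_def using continuous_map_into_fulltopology continuous_map_snd by blast
      then show ?thesis using 1 by (simp add: f_def continuous_map_from_subtopology)
    next
      case 2
      then show ?thesis using c by (simp add: f_def)
    next
      case 3
      have "subtopology Z (T i) = prod_topology ?I (subtopology W S)"
        using 3 SV by (simp add: Z_def T_def subtopology_Times subtopology_subtopology inf.absorb2)
      then show ?thesis using 3 H by (simp add: f_def)
    qed
  qed
  obtain g where g: "continuous_map (subtopology Z A) W g"
    and gf: "\<And>x i. \<lbrakk>i \<in> {..<3}; x \<in> topspace (subtopology Z A) \<inter> T i\<rbrakk> \<Longrightarrow> g x = f i x"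
  proof (rule pasting_lemma_exists_closed[of "{..<3::nat}" "subtopology Z A" T W f])
    show "closedin (subtopology Z A) (T i)" if "i \<in> {..<3}" for i
      using Tclosed that by (intro closedin_subset_topspace) (auto simp: A_def)
    show "continuous_map (subtopology (subtopology Z A) (T i)) W (f i)" if "i \<in> {..<3}" for i
    proof -
      have "T i \<subseteq> A" using that by (auto simp: A_def)
      then show ?thesis using fc[of i] by (simp add: subtopology_subtopology inf.absorb2)
    qed
    show "f i x = f j x"
      if "i \<in> {..<3}" "j \<in> {..<3}" "x \<in> topspace (subtopology Z A) \<inter> T i \<inter> T j" for i j x
      using that H01 by (auto simp: T_def f_def split: if_splits)
  qed (auto simp: A_def)
  obtain N h where N: "openin Z N" "A \<subseteq> N" and h: "continuous_map (subtopology Z N) W h"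
    and hg: "\<And>a. a \<in> A \<Longrightarrow> h a = g a"
    using metric_ANR_neighbourhood_extension[OF anr Zmet Aclosed g] by blast
  define V' where "V' = {x \<in> topspace (subtopology W V). {0..1} \<times> {x} \<subseteq> N}"
  have V'V: "V' \<subseteq> V" by (auto simp: V'_def)
  have "openin (subtopology W V) V'"
    unfolding V'_def using N(1) unfolding Z_def by (rule openin_tube[rotated]) (simp add: compactin_subtopology)
  then have "openin W V'"
    using V openin_trans_full by blast
  moreover have "S \<subseteq> V'"
  proof
    fix x assume "x \<in> S"
    then have "{0..1} \<times> {x} \<subseteq> T 2" by (auto simp: T_def)
    then have "{0..1} \<times> {x} \<subseteq> N" using N(2) unfolding A_def by force
    then show "x \<in> V'" using \<open>x \<in> S\<close> SV VW by (auto simp: V'_def)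
  qed
  moreover have "contractible_within W V'"
  proof -
    have IV': "{0..1} \<times> V' \<subseteq> N" by (auto simp: V'_def)
    have "({0..1} \<times> V) \<inter> N \<inter> ({0..1} \<times> V') = {0..1} \<times> V'"
      using V'V IV' by blast
    then have "prod_topology ?I (subtopology W V') = subtopology (subtopology Z N) ({0..1} \<times> V')"
      by (simp add: Z_def subtopology_subtopology flip: subtopology_Times)
    then have hc: "continuous_map (prod_topology ?I (subtopology W V')) W h"
      using h by (simp add: continuous_map_from_subtopology)
    have "h (0, x) = x" "h (1, x) = c" if "x \<in> V'" for x
    proof -
      have xV: "x \<in> V" using that V'V by blast
      then have 0: "(0, x) \<in> T 0" "(0, x) \<in> A" by (force simp: T_def A_def)+
      from xV have 1: "(1, x) \<in> T 1" "(1, x) \<in> A" by (force simp: T_def A_def)+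
      show "h (0, x) = x" "h (1, x) = c"
        using hg 0 1 gf[of 0 "(0, x)"] gf[of 1 "(1, x)"] xV tZ by (auto simp: f_def)
    qed
    then have "homotopic_with (\<lambda>_. True) (subtopology W V') W id (\<lambda>_. c)"
      using hc V'V VW by (subst homotopic_with) (auto intro!: exI[of _ h])
    then show ?thesis using c V'V VW by (auto simp: contractible_within_def)
  qed
  ultimately show ?thesis using that by blast
qed

section \<open>The category of the base\<close>

text \<open>
  If \<open>h\<close> contracts \<open>s ` A\<close> in \<open>C\<close>, then \<open>f \<circ> h \<circ> s\<close> contracts \<open>A\<close> in \<open>W\<close>, starting at
  \<open>f \<circ> s = id\<close>.
\<close>

lemma categorical_section_imp_contractible_within:
  assumes f: "continuous_map C W f" and s: "categorical_section C W f A s"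
  shows "contractible_within W A"
proof -
  have A: "A \<subseteq> topspace W" and sc: "continuous_map (subtopology W A) C s" and fs: "\<forall>w\<in>A. f (s w) = w"
    using s by (auto simp: categorical_section_def partial_section_def)
  obtain c where c: "c \<in> topspace C"
    and h: "homotopic_with (\<lambda>_. True) (subtopology C (s ` A)) C id (\<lambda>_. c)"
    using s by (auto simp: categorical_section_def contractible_within_def)
  have "continuous_map (subtopology W A) (subtopology C (s ` A)) s"
    using sc by (auto simp: continuous_map_in_subtopology)
  then have "homotopic_with (\<lambda>_. True) (subtopology W A) C (id \<circ> s) ((\<lambda>_. c) \<circ> s)"
    by (rule homotopic_with_compose_continuous_map_right[OF h]) auto
  then have "homotopic_with (\<lambda>_. True) (subtopology W A) W (f \<circ> (id \<circ> s)) (f \<circ> ((\<lambda>_. c) \<circ> s))"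
    by (rule homotopic_with_compose_continuous_map_left[OF _ f]) auto
  then have "homotopic_with (\<lambda>_. True) (subtopology W A) W id (\<lambda>_. f c)"
    by (rule homotopic_with_eq) (use fs in auto)
  moreover have "f c \<in> topspace W"
    using f c continuous_map_image_subset_topspace by blast
  ultimately show ?thesis
    using A by (auto simp: contractible_within_def)
qed

text \<open>
  The stratum \<open>A (Suc i) - A i\<close> is closed in the open complement of \<open>A i\<close>, so it can be enlarged to an
  open set that is contractible within \<open>W\<close>. The enlarged strata still cover.
\<close>

lemma LS_cat_le_csec:
  assumes anr: "metric_ANR_space W" and f: "continuous_map C W f"
  shows "LS_cat W \<le> csec C W f"
  unfolding csec_def LS_cat_def
proof (rule Inf_superset_mono, clarify)
  fix n A
  assume A: "closed_filtration W n A"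
    and sec: "\<forall>i<n. \<exists>s. categorical_section C W f (A (Suc i) - A i) s"
  have "\<exists>V. openin W V \<and> A (Suc i) - A i \<subseteq> V \<and> contractible_within W V" if i: "i < n" for i
  proof -
    have clo: "closedin W (A i)" "closedin W (A (Suc i))"
      using A i by (auto simp: closed_filtration_def)
    have "closedin (subtopology W (topspace W - A i)) (A (Suc i) - A i)"
      using clo(2) closedin_subset[OF clo(2)] unfolding closedin_subtopology
      by (intro exI[of _ "A (Suc i)"]) auto
    moreover have "openin W (topspace W - A i)" using clo(1) by blast
    moreover have "contractible_within W (A (Suc i) - A i)"
      using sec i categorical_section_imp_contractible_within[OF f] by blast
    ultimately show ?thesis
      using metric_ANR_contractible_neighbourhood[OF anr] by metis
  qed
  then obtain V where V: "\<And>i. i < n \<Longrightarrow> openin W (V i) \<and> A (Suc i) - A i \<subseteq> V i \<and> contractible_within W (V i)"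
    by metis
  have "A k \<subseteq> (\<Union>i<k. V i)" if "k \<le> n" for k
    using that
  proof (induction k)
    case 0
    then show ?case using A by (simp add: closed_filtration_def)
  next
    case (Suc k)
    then show ?case using V[of k] by (auto simp: lessThan_Suc)
  qed
  then have "topspace W \<subseteq> (\<Union>i<n. V i)"
    using A unfolding closed_filtration_def by (metis order_refl)
  moreover have "(\<Union>i<n. V i) \<subseteq> topspace W"
    using V openin_subset by blast
  ultimately show "\<exists>n'. enat n = enat n' \<and> (\<exists>U. (\<forall>i<n'. openin W (U i) \<and> contractible_within W (U i)) \<and>
       (\<Union>i<n'. U i) = topspace W)"
    using V by blast
qed

theorem theorem5p1:
  fixes C :: "'c topology" and W :: "'w topology" and f :: "'c \<Rightarrow> 'w"
  assumes "topspace C \<noteq> {}" and "topspace W \<noteq> {}"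
    and "path_connected_space C" and "path_connected_space W"
    and "metric_ANR_space W"
    and "continuous_map C W f" and "f ` topspace C = topspace W"
  shows "LS_cat W \<le> csec C W f \<and> csec C W f \<le> TC C W f \<and> TC C W f \<le> csec C W f + LS_cat C - 1"
  using LS_cat_le_csec[OF assms(5,6)] csec_le_TC[OF assms(1,6)] TC_le_csec_plus_cat[OF assms(3,1,2)]
  by blast

end
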